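(* Let $\Delta$ be a finite simplicial complex. Let $K_1$ be the set of diagonal congruence classes of forms $q\in\mathcal{P}(\Delta)$ of full support with local rank $1$, regarded as a semigroup under the Hadamard product. Then the semigroup $K_1$ is isomorphic to the simplicial cohomology group $H^1(\Delta,\mathbb{Z}/2\mathbb{Z})$.
   Context: A simplicial complex $\Delta$ on a finite vertex set $V(\Delta)$ is a family of subsets of $V(\Delta)$ (called faces) that is closed under taking subsets and contains all singletons. Let $I(\Delta)\subseteq\mathbb{R}[x_i:i\in V(\Delta)]$ be the ideal generated by the monomials $\prod_{i\in S}x_i$ with $S\subseteq V(\Delta)$, $S\notin\Delta$, and let $R_2(\Delta)$ be the degree 2 homogeneous part of $\mathbb{R}[x_i:i\in V(\Delta)]/I(\Delta)$. Elements of $R_2(\Delta)$ are regarded as functions on $\bigcup_{F\in\Delta}\operatorname{span}\{e_i:i\in F\}\subseteq\mathbb{R}^{V(\Delta)}$. Let $\mathcal{P}(\Delta)\subseteq R_2(\Delta)$ be the convex cone of quadratic forms that are nonnegative on this union. Each $q\in R_2(\Delta)$ is uniquely represented by a symmetric partial matrix $X=(X_{i,j})$, with entries specified exactly for $\{i,j\}\in\Delta$ ($i=j$ allowed), via $q=\sum_i X_{i,i}x_i^2+2\sum_{\{i,j\}\in\Delta,\,i\ne j}X_{i,j}x_ix_j$. For a face $F$ let $X|_F$ be the (fully specified) principal submatrix indexed by $F$; then $q\in\mathcal{P}(\Delta)$ iff every $X|_F$, $F\in\Delta$, is positive semidefinite. The local rank of $q\in\mathcal{P}(\Delta)$ is $\max_{F\in\Delta}\operatorname{rank}(X|_F)$.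 The form $q$ has full support if $q(e_i)=X_{i,i}>0$ for all $i\in V(\Delta)$. Two forms represented by $X$ and $Y$ are diagonally congruent if there is an invertible real diagonal matrix $D$ with $Y_{i,j}=D_{i,i}D_{j,j}X_{i,j}$ for all $\{i,j\}\in\Delta$. The Hadamard product of the forms represented by $X$ and $Y$ is the form represented by the entrywise product $(X_{i,j}Y_{i,j})$; on diagonal congruence classes the product is the class of the Hadamard product of representatives, which is well defined on $K_1$. *)

theory Defs
  imports "HOL-Analysis.Analysis" "HOL-Algebra.Coset" "HOL-Library.Poly_Mapping" "HOL-Library.Z2"
begin

section \<open>Simplicial complexes and the ring of quadratic forms\<close>

text \<open>The vertex set is the finite (hence nonempty) type \<open>'v\<close>.\<close>

definition finite_complex :: "'v::finite set set \<Rightarrow> bool" where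
  "finite_complex \<Delta> \<longleftrightarrow> (\<forall>F\<in>\<Delta>. \<forall>G\<subseteq>F. G \<in> \<Delta>) \<and> (\<forall>v. {v} \<in> \<Delta>)"

text \<open>The polynomial ring \<open>\<real>[x\<^sub>i : i \<in> 'v]\<close> as the monoid algebra of exponent vectors.\<close>

type_synonym 'v rpoly = "('v \<Rightarrow>\<^sub>0 nat) \<Rightarrow>\<^sub>0 real"

definition var :: "'v \<Rightarrow> 'v rpoly" where
  "var i = Poly_Mapping.single (Poly_Mapping.single i 1) 1"

definition const :: "real \<Rightarrow> 'v rpoly" where
  "const c = Poly_Mapping.single 0 c"

definition poly_eval :: "'v::finite rpoly \<Rightarrow> real ^ 'v \<Rightarrow> real" where
  "poly_eval p x = (\<Sum>m\<in>Poly_Mapping.keys p.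
     Poly_Mapping.lookup p m * (\<Prod>i\<in>UNIV. (x $ i) ^ Poly_Mapping.lookup m i))"

definition homogeneous :: "nat \<Rightarrow> 'v::finite rpoly \<Rightarrow> bool" where
  "homogeneous d p \<longleftrightarrow>
     (\<forall>m\<in>Poly_Mapping.keys p. (\<Sum>i\<in>UNIV. Poly_Mapping.lookup m i) = d)"

text \<open>The ideal generated by a set is the span of that set over the ring itself.\<close>

definition SR_ideal :: "'v::finite set set \<Rightarrow> 'v rpoly set" where
  "SR_ideal \<Delta> = module.span (*) {\<Prod>i\<in>S. var i | S. S \<notin> \<Delta>}"

definition SR_rel :: "'v::finite set set \<Rightarrow> ('v rpoly \<times> 'v rpoly) set" where
  "SR_rel \<Delta> = {(p, r). p - r \<in> SR_ideal \<Delta>}"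

text \<open>Degree 2 part of the quotient: the cosets of the homogeneous polynomials of degree 2.\<close>

definition R2 :: "'v::finite set set \<Rightarrow> 'v rpoly set set" where
  "R2 \<Delta> = {p. homogeneous 2 p} // SR_rel \<Delta>"

definition support_union :: "'v::finite set set \<Rightarrow> (real ^ 'v) set" where
  "support_union \<Delta> = (\<Union>F\<in>\<Delta>. span ((\<lambda>i. axis i 1) ` F))"

text \<open>Value of a coset at a point of \<open>support_union \<Delta>\<close>, where all its representatives agree
  (lemma \<open>form_value_coset\<close> below).\<close>

definition form_value :: "'v::finite rpoly set \<Rightarrow> real ^ 'v \<Rightarrow> real" where
  "form_value q x = the_elem ((\<lambda>p. poly_eval p x) ` q)"

definition Pcone :: "'v::finite set set \<Rightarrow> 'v rpoly set set" where
  "Pcone \<Delta> = {q \<in> R2 \<Delta>. \<forall>x\<in>support_union \<Delta>. form_value q x \<ge> 0}"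

section \<open>Partial matrices\<close>

text \<open>Unspecified entries are stored as 0.\<close>

definition partial_matrix :: "'v::finite set set \<Rightarrow> real ^ 'v ^ 'v \<Rightarrow> bool" where
  "partial_matrix \<Delta> X \<longleftrightarrow>
     (\<forall>i j. X $ i $ j = X $ j $ i) \<and> (\<forall>i j. {i, j} \<notin> \<Delta> \<longrightarrow> X $ i $ j = 0)"

text \<open>The second sum ranges over ordered pairs, so each edge contributes twice; this is the
  factor 2 in \<open>\<Sum>\<^sub>i X\<^sub>i\<^sub>i x\<^sub>i\<^sup>2 + 2 \<Sum> X\<^sub>i\<^sub>j x\<^sub>i x\<^sub>j\<close> over (unordered) edges.\<close>

definition matrix_poly :: "'v::finite set set \<Rightarrow> real ^ 'v ^ 'v \<Rightarrow> 'v rpoly" where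
  "matrix_poly \<Delta> X = (\<Sum>i\<in>UNIV. const (X $ i $ i) * var i ^ 2) +
      (\<Sum>(i, j) | i \<noteq> j \<and> {i, j} \<in> \<Delta>. const (X $ i $ j) * var i * var j)"

definition form_of :: "'v::finite set set \<Rightarrow> real ^ 'v ^ 'v \<Rightarrow> 'v rpoly set" where
  "form_of \<Delta> X = SR_rel \<Delta> `` {matrix_poly \<Delta> X}"

text \<open>Existence and uniqueness: lemma \<open>form_matrix_unique\<close> below.\<close>

definition form_matrix :: "'v::finite set set \<Rightarrow> 'v rpoly set \<Rightarrow> real ^ 'v ^ 'v" where
  "form_matrix \<Delta> q = (THE X. partial_matrix \<Delta> X \<and> form_of \<Delta> X = q)"

text \<open>The principal submatrix indexed by \<open>F\<close>, padded with zero rows and columns; the padding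
  does not change the rank.\<close>

definition face_submatrix :: "real ^ 'v ^ 'v \<Rightarrow> 'v::finite set \<Rightarrow> real ^ 'v ^ 'v" where
  "face_submatrix X F = (\<chi> i j. if i \<in> F \<and> j \<in> F then X $ i $ j else 0)"

definition local_rank :: "'v::finite set set \<Rightarrow> 'v rpoly set \<Rightarrow> nat" where
  "local_rank \<Delta> q = Max ((\<lambda>F. rank (face_submatrix (form_matrix \<Delta> q) F)) ` \<Delta>)"

definition full_support :: "'v::finite rpoly set \<Rightarrow> bool" where
  "full_support q \<longleftrightarrow> (\<forall>i. form_value q (axis i 1) > 0)"

section \<open>The semigroup of diagonal congruence classes\<close>

definition diag_cong :: "'v::finite set set \<Rightarrow> ('v rpoly set \<times> 'v rpoly set) set" where
  "diag_cong \<Delta> = {(q, r). q \<in> R2 \<Delta> \<and> r \<in> R2 \<Delta> \<and>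
     (\<exists>D :: real ^ 'v ^ 'v. invertible D \<and> (\<forall>i j. i \<noteq> j \<longrightarrow> D $ i $ j = 0) \<and>
        (\<forall>i j. {i, j} \<in> \<Delta> \<longrightarrow>
           form_matrix \<Delta> r $ i $ j = D $ i $ i * D $ j $ j * form_matrix \<Delta> q $ i $ j))}"

definition hadamard :: "'v::finite set set \<Rightarrow> 'v rpoly set \<Rightarrow> 'v rpoly set \<Rightarrow> 'v rpoly set" where
  "hadamard \<Delta> q r = form_of \<Delta> (\<chi> i j. form_matrix \<Delta> q $ i $ j * form_matrix \<Delta> r $ i $ j)"

definition K1 :: "'v::finite set set \<Rightarrow> 'v rpoly set set set" where
  "K1 \<Delta> = {q \<in> Pcone \<Delta>. full_support q \<and> local_rank \<Delta> q = 1} // diag_cong \<Delta>"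

text \<open>Union of the classes of all products of representatives.  It is a single class precisely
  when the class of the product does not depend on the representatives.\<close>

definition class_prod ::
  "'v::finite set set \<Rightarrow> 'v rpoly set set \<Rightarrow> 'v rpoly set set \<Rightarrow> 'v rpoly set set" where
  "class_prod \<Delta> A B = (\<Union>q\<in>A. \<Union>r\<in>B. diag_cong \<Delta> `` {hadamard \<Delta> q r})"

section \<open>Simplicial cohomology with coefficients in \<open>\<int>/2\<int>\<close>\<close>

text \<open>The coefficients are the two-element field \<^typ>\<open>bit\<close>, so no orientations or signs are
  needed.  A \<open>k\<close>-cochain is a function on the faces of cardinality \<open>k + 1\<close>, extended by 0.\<close>

definition cochains :: "'v set set \<Rightarrow> nat \<Rightarrow> ('v set \<Rightarrow> bit) set" where
  "cochains \<Delta> k = {f. \<forall>F. \<not> (F \<in> \<Delta> \<and> card F = k + 1) \<longrightarrow> f F = 0}"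

definition coboundary :: "'v set set \<Rightarrow> nat \<Rightarrow> ('v set \<Rightarrow> bit) \<Rightarrow> ('v set \<Rightarrow> bit)" where
  "coboundary \<Delta> k f = (\<lambda>F. if F \<in> \<Delta> \<and> card F = k + 2 then \<Sum>v\<in>F. f (F - {v}) else 0)"

definition cocycle_group :: "'v set set \<Rightarrow> nat \<Rightarrow> ('v set \<Rightarrow> bit) monoid" where
  "cocycle_group \<Delta> k =
     \<lparr>carrier = {f \<in> cochains \<Delta> k. coboundary \<Delta> k f = (\<lambda>_. 0)},
      mult = (\<lambda>f g F. f F + g F), one = (\<lambda>_. 0)\<rparr>"

definition coboundaries :: "'v set set \<Rightarrow> nat \<Rightarrow> ('v set \<Rightarrow> bit) set" where
  "coboundaries \<Delta> k = (case k of 0 \<Rightarrow> {\<lambda>_. 0} | Suc l \<Rightarrow> coboundary \<Delta> l ` cochains \<Delta> l)"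

definition cohomology :: "'v set set \<Rightarrow> nat \<Rightarrow> ('v set \<Rightarrow> bit) set monoid" where
  "cohomology \<Delta> k = cocycle_group \<Delta> k Mod coboundaries \<Delta> k"

section \<open>Well-definedness of \<open>form_value\<close> and \<open>form_matrix\<close>\<close>

lemma module_rpoly: "module ((*) :: 'v rpoly \<Rightarrow> 'v rpoly \<Rightarrow> 'v rpoly)"
  by unfold_locales (auto simp: algebra_simps)

lemma keys_add_exponents:
  "Poly_Mapping.keys ((a :: 'v \<Rightarrow>\<^sub>0 nat) + b) = Poly_Mapping.keys a \<union> Poly_Mapping.keys b"
  by (auto simp: in_keys_iff lookup_add)

lemma prod_var:
  assumes "finite S"
  shows "(\<Prod>i\<in>S. var i) = Poly_Mapping.single (\<Sum>i\<in>S. Poly_Mapping.single i 1) 1"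
  using assms by (induction S rule: finite_induct) (auto simp: var_def mult_single)

lemma lookup_indicator_exponent:
  assumes "finite S"
  shows "Poly_Mapping.lookup (\<Sum>i\<in>S. Poly_Mapping.single i 1) j = (if j \<in> S then 1 else (0::nat))"
  using assms
  by (simp add: lookup_sum lookup_single when_def)

lemma rpoly_expand: "p = (\<Sum>m\<in>Poly_Mapping.keys p. Poly_Mapping.single m (Poly_Mapping.lookup p m))"
proof (rule poly_mapping_eqI)
  fix k
  show "Poly_Mapping.lookup p k = Poly_Mapping.lookup (\<Sum>m\<in>Poly_Mapping.keys p. Poly_Mapping.single m (Poly_Mapping.lookup p m)) k"
    by (simp add: lookup_sum lookup_single when_def sum.delta' in_keys_iff)
qed

lemma SR_ideal_iff:
  assumes "finite_complex \<Delta>"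
  shows "p \<in> SR_ideal \<Delta> \<longleftrightarrow> (\<forall>m\<in>Poly_Mapping.keys p. Poly_Mapping.keys m \<notin> \<Delta>)"
proof
  interpret M: module "(*) :: 'a rpoly \<Rightarrow> 'a rpoly \<Rightarrow> 'a rpoly" by (rule module_rpoly)
  assume "p \<in> SR_ideal \<Delta>"
  then have "p \<in> M.span {\<Prod>i\<in>S. var i | S. S \<notin> \<Delta>}" by (simp add: SR_ideal_def)
  then show "\<forall>m\<in>Poly_Mapping.keys p. Poly_Mapping.keys m \<notin> \<Delta>"
  proof (induction rule: M.span_induct_alt)
    case base
    then show ?case by simp
  next
    case (step c x y)
    then obtain S where S: "x = (\<Prod>i\<in>S. var i)" "S \<notin> \<Delta>" by auto
    show ?case
    proof
      fix m assume "m \<in> Poly_Mapping.keys (c * x + y)"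
      then consider "m \<in> Poly_Mapping.keys (c * x)" | "m \<in> Poly_Mapping.keys y"
        using keys_add[of "c * x" y] by blast
      then show "Poly_Mapping.keys m \<notin> \<Delta>"
      proof cases
        case 1
        then obtain a where a: "m = a + (\<Sum>i\<in>S. Poly_Mapping.single i 1)"
          using keys_mult[of c x] by (auto simp: S prod_var)
        have "Poly_Mapping.keys (\<Sum>i\<in>S. Poly_Mapping.single i (1::nat)) = S"
          unfolding set_eq_iff in_keys_iff lookup_indicator_exponent[OF finite] by simp
        then have "S \<subseteq> Poly_Mapping.keys m" by (simp add: a keys_add_exponents)
        then show ?thesis using S(2) assms unfolding finite_complex_def by blast
      next
        case 2
        then show ?thesis using step by blast
      qed
    qed
  qed
next
  interpret M: module "(*) :: 'a rpoly \<Rightarrow> 'a rpoly \<Rightarrow> 'a rpoly" by (rule module_rpoly)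
  assume p: "\<forall>m\<in>Poly_Mapping.keys p. Poly_Mapping.keys m \<notin> \<Delta>"
  have "Poly_Mapping.single m (Poly_Mapping.lookup p m) \<in> SR_ideal \<Delta>" if "m \<in> Poly_Mapping.keys p" for m
  proof -
    define s where "s = (\<Sum>i\<in>Poly_Mapping.keys m. Poly_Mapping.single i (1::nat))"
    have ms: "m = (m - s) + s"
    proof (rule poly_mapping_eqI)
      fix k
      show "Poly_Mapping.lookup m k = Poly_Mapping.lookup (m - s + s) k"
        unfolding lookup_add lookup_minus s_def lookup_indicator_exponent[OF finite_keys]
        by (simp add: in_keys_iff)
    qed
    have "Poly_Mapping.single m (Poly_Mapping.lookup p m) =
      Poly_Mapping.single (m - s) (Poly_Mapping.lookup p m) * (\<Prod>i\<in>Poly_Mapping.keys m. var i)"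
      unfolding prod_var[OF finite_keys] s_def[symmetric] mult_single ms[symmetric] by simp
    moreover have "(\<Prod>i\<in>Poly_Mapping.keys m. var i) \<in> M.span {\<Prod>i\<in>S. var i | S. S \<notin> \<Delta>}"
      using p that by (intro M.span_base) blast
    ultimately show ?thesis unfolding SR_ideal_def by (simp add: M.span_scale)
  qed
  then have "(\<Sum>m\<in>Poly_Mapping.keys p. Poly_Mapping.single m (Poly_Mapping.lookup p m)) \<in> SR_ideal \<Delta>"
    unfolding SR_ideal_def by (intro M.span_sum) auto
  then show "p \<in> SR_ideal \<Delta>" by (subst rpoly_expand)
qed

lemma equiv_SR_rel: "equiv UNIV (SR_rel \<Delta>)"
proof -
  interpret M: module "(*) :: 'a rpoly \<Rightarrow> 'a rpoly \<Rightarrow> 'a rpoly" by (rule module_rpoly)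
  show ?thesis
  proof (rule equivI)
    show "refl (SR_rel \<Delta>)" by (auto simp: refl_on_def SR_rel_def SR_ideal_def M.span_zero)
    show "sym (SR_rel \<Delta>)"
      unfolding sym_def SR_rel_def SR_ideal_def
      by (auto dest: M.span_neg)
    show "trans (SR_rel \<Delta>)"
      unfolding trans_def SR_rel_def SR_ideal_def
      using M.span_add by force
  qed simp
qed

lemma SR_rel_iff:
  assumes "finite_complex \<Delta>"
  shows "(p, r) \<in> SR_rel \<Delta> \<longleftrightarrow>
    (\<forall>m. Poly_Mapping.keys m \<in> \<Delta> \<longrightarrow> Poly_Mapping.lookup p m = Poly_Mapping.lookup r m)"
  unfolding SR_rel_def by (auto simp: SR_ideal_iff[OF assms] in_keys_iff lookup_minus)

lemma support_union_iff:
  assumes "x \<in> support_union \<Delta>" "finite_complex \<Delta>"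
  shows "{i. x $ i \<noteq> 0} \<in> \<Delta>"
proof -
  obtain F where F: "F \<in> \<Delta>" "x \<in> span ((\<lambda>i. axis i 1) ` F)"
    using assms(1) by (auto simp: support_union_def)
  have "x $ j = 0" if "j \<notin> F" for j
    using F(2)
  proof (induction rule: span_induct_alt)
    case (step c y z)
    then obtain i where "i \<in> F" "y = axis i 1" by blast
    then show ?case using that step by (auto simp: axis_def)
  qed simp
  then have "{i. x $ i \<noteq> 0} \<subseteq> F" by auto
  then show ?thesis using F(1) assms(2) unfolding finite_complex_def by blast
qed

lemma poly_eval_cong:
  assumes "finite_complex \<Delta>" "x \<in> support_union \<Delta>" "(p, r) \<in> SR_rel \<Delta>"
  shows "poly_eval p x = poly_eval r x"
proof -
  let ?K = "Poly_Mapping.keys p \<union> Poly_Mapping.keys r"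
  let ?t = "\<lambda>m. (\<Prod>i\<in>UNIV. (x $ i) ^ Poly_Mapping.lookup m i)"
  have e: "poly_eval q x = (\<Sum>m\<in>?K. Poly_Mapping.lookup q m * ?t m)"
    if "Poly_Mapping.keys q \<subseteq> ?K" for q
    unfolding poly_eval_def by (rule sum.mono_neutral_left) (use that in \<open>auto simp: in_keys_iff\<close>)
  have "Poly_Mapping.lookup p m * ?t m = Poly_Mapping.lookup r m * ?t m" for m
  proof (cases "Poly_Mapping.keys m \<in> \<Delta>")
    case True
    then show ?thesis using assms(3) by (simp add: SR_rel_iff[OF assms(1)])
  next
    case False
    then have "\<not> Poly_Mapping.keys m \<subseteq> {i. x $ i \<noteq> 0}"
      using support_union_iff[OF assms(2,1)] assms(1) unfolding finite_complex_def by blast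
    then obtain i where "i \<in> Poly_Mapping.keys m" "x $ i = 0" by blast
    then have "(x $ i) ^ Poly_Mapping.lookup m i = 0" by (simp add: in_keys_iff)
    then have "?t m = 0" by (intro prod_zero) auto
    then show ?thesis by simp
  qed
  then have "(\<Sum>m\<in>?K. Poly_Mapping.lookup p m * ?t m) = (\<Sum>m\<in>?K. Poly_Mapping.lookup r m * ?t m)"
    by (intro sum.cong refl)
  then show ?thesis using e[of p] e[of r] by (metis Un_upper1 Un_upper2)
qed

lemma form_value_coset:
  assumes "finite_complex \<Delta>" "x \<in> support_union \<Delta>"
  shows "form_value (SR_rel \<Delta> `` {p}) x = poly_eval p x"
proof -
  have "p \<in> SR_rel \<Delta> `` {p}"
    using equiv_SR_rel[of \<Delta>] by (simp add: equiv_def refl_on_def)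
  moreover have "poly_eval r x = poly_eval p x" if "r \<in> SR_rel \<Delta> `` {p}" for r
    by (rule poly_eval_cong[OF assms, symmetric]) (use that in blast)
  ultimately have "(\<lambda>r. poly_eval r x) ` (SR_rel \<Delta> `` {p}) = {poly_eval p x}" by blast
  then show ?thesis by (simp add: form_value_def)
qed

abbreviation pair_exp :: "'v \<Rightarrow> 'v \<Rightarrow> 'v \<Rightarrow>\<^sub>0 nat" where
  "pair_exp i j \<equiv> Poly_Mapping.single i 1 + Poly_Mapping.single j 1"

lemma keys_pair_exp: "Poly_Mapping.keys (pair_exp i j) = {i, j}"
  by (auto simp: keys_add_exponents)

lemma pair_exp_eq_iff: "pair_exp i j = pair_exp k l \<longleftrightarrow> {i, j} = {k, l}"
proof
  assume "pair_exp i j = pair_exp k l"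
  then show "{i, j} = {k, l}" by (metis keys_pair_exp)
next
  assume "{i, j} = {k, l}"
  then show "pair_exp i j = pair_exp k l" by (auto simp: doubleton_eq_iff add.commute)
qed

lemma lookup_matrix_poly:
  "Poly_Mapping.lookup (matrix_poly \<Delta> X) m =
     (\<Sum>i\<in>UNIV. if m = pair_exp i i then X $ i $ i else 0) +
     (\<Sum>(i, j) | i \<noteq> j \<and> {i, j} \<in> \<Delta>. if m = pair_exp i j then X $ i $ j else 0)"
proof -
  have "const c * var i * var j = Poly_Mapping.single (pair_exp i j) c" for c and i j :: 'a
    by (simp add: const_def var_def mult_single)
  moreover from this have "const c * var i ^ 2 = Poly_Mapping.single (pair_exp i i) c" for c and i :: 'a
    by (simp add: power2_eq_square mult.assoc)
  ultimately show ?thesis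
    unfolding matrix_poly_def lookup_add lookup_sum
    by (auto intro!: arg_cong2[where f="(+)"] sum.cong simp: lookup_single when_def)
qed

lemma lookup_matrix_poly_pair:
  assumes "finite_complex \<Delta>" "{i, j} \<in> \<Delta>" "X $ i $ j = X $ j $ i"
  shows "Poly_Mapping.lookup (matrix_poly \<Delta> X) (pair_exp i j) =
    (if i = j then X $ i $ i else 2 * X $ i $ j)"
proof (cases "i = j")
  case True
  have 1: "(\<Sum>k\<in>UNIV. if pair_exp i i = pair_exp k k then X $ k $ k else 0) = X $ i $ i"
    unfolding pair_exp_eq_iff by simp
  have 2: "(\<Sum>(k, l) | k \<noteq> l \<and> {k, l} \<in> \<Delta>. if pair_exp i i = pair_exp k l then X $ k $ l else 0) = 0"
    unfolding pair_exp_eq_iff by (rule sum.neutral) (auto simp: doubleton_eq_iff)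
  have "Poly_Mapping.lookup (matrix_poly \<Delta> X) (pair_exp i i) = X $ i $ i"
    unfolding lookup_matrix_poly 1 2 by simp
  then show ?thesis using True by simp
next
  case False
  have 1: "(\<Sum>k\<in>UNIV. if pair_exp i j = pair_exp k k then X $ k $ k else 0) = 0"
    unfolding pair_exp_eq_iff by (rule sum.neutral) (use False in auto)
  have "(\<Sum>(k, l) | k \<noteq> l \<and> {k, l} \<in> \<Delta>. if pair_exp i j = pair_exp k l then X $ k $ l else 0)
    = (\<Sum>(k, l)\<in>{(i, j), (j, i)}. X $ k $ l)"
    unfolding pair_exp_eq_iff
    by (rule sum.mono_neutral_cong_right)
       (use False assms in \<open>auto simp: doubleton_eq_iff insert_commute split: if_splits\<close>)
  also have "\<dots> = 2 * X $ i $ j" using False assms(3) by simp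
  finally have "Poly_Mapping.lookup (matrix_poly \<Delta> X) (pair_exp i j) = 2 * X $ i $ j"
    unfolding lookup_matrix_poly 1 by simp
  then show ?thesis using False by simp
qed

lemma degree_two_exponent:
  fixes m :: "'v::finite \<Rightarrow>\<^sub>0 nat"
  assumes "(\<Sum>i\<in>UNIV. Poly_Mapping.lookup m i) = 2"
  obtains i j where "m = pair_exp i j"
proof -
  have "\<exists>i. Poly_Mapping.lookup m i \<noteq> 0" by (rule ccontr) (use assms in simp)
  then obtain i where i: "Poly_Mapping.lookup m i \<noteq> 0" by blast
  define n where "n = m - Poly_Mapping.single i 1"
  have m: "m = n + Poly_Mapping.single i 1"
    using i by (intro poly_mapping_eqI) (auto simp: n_def lookup_add lookup_minus lookup_single when_def)
  have n1: "(\<Sum>k\<in>UNIV. Poly_Mapping.lookup n k) = 1"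
    using assms by (simp add: m lookup_add sum.distrib lookup_single when_def)
  have "\<exists>j. Poly_Mapping.lookup n j \<noteq> 0" by (rule ccontr) (use n1 in simp)
  then obtain j where j: "Poly_Mapping.lookup n j \<noteq> 0" by blast
  define l where "l = n - Poly_Mapping.single j 1"
  have n: "n = l + Poly_Mapping.single j 1"
    using j by (intro poly_mapping_eqI) (auto simp: l_def lookup_add lookup_minus lookup_single when_def)
  have "(\<Sum>k\<in>UNIV. Poly_Mapping.lookup l k) = 0"
    using n1 by (simp add: n lookup_add sum.distrib lookup_single when_def)
  then have "l = 0" by (intro poly_mapping_eqI) simp
  then show ?thesis using m n that[of j i] by simp
qed

lemma homogeneous_matrix_poly: "homogeneous 2 (matrix_poly \<Delta> X)"
  unfolding homogeneous_def
proof
  fix m assume "m \<in> Poly_Mapping.keys (matrix_poly \<Delta> X)"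
  then have "Poly_Mapping.lookup (matrix_poly \<Delta> X) m \<noteq> 0" by (simp add: in_keys_iff)
  then have "\<exists>i j. m = pair_exp i j"
    unfolding lookup_matrix_poly
    by (rule contrapos_np) (auto intro!: sum.neutral)
  then show "(\<Sum>i\<in>UNIV. Poly_Mapping.lookup m i) = 2"
    by (auto simp: lookup_add sum.distrib lookup_single when_def)
qed

lemma form_of_in_R2: "form_of \<Delta> X \<in> R2 \<Delta>"
  unfolding R2_def form_of_def
  by (rule quotientI) (simp add: homogeneous_matrix_poly)

lemma form_matrix_unique:
  assumes "finite_complex \<Delta>" "q \<in> R2 \<Delta>"
  shows "\<exists>!X. partial_matrix \<Delta> X \<and> form_of \<Delta> X = q"
proof -
  obtain p where p: "homogeneous 2 p" "q = SR_rel \<Delta> `` {p}"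
    using assms(2) by (auto simp: R2_def quotient_def)
  define X where "X = (\<chi> i j. if {i, j} \<in> \<Delta> then
    Poly_Mapping.lookup p (pair_exp i j) / (if i = j then 1 else 2) else 0)"
  have X: "partial_matrix \<Delta> X"
    by (auto simp: partial_matrix_def X_def insert_commute add.commute)
  have iff: "form_of \<Delta> Y = q \<longleftrightarrow> (matrix_poly \<Delta> Y, p) \<in> SR_rel \<Delta>" for Y
    unfolding form_of_def p(2)
    using eq_equiv_class_iff[OF equiv_SR_rel] by blast
  have ent: "Y $ i $ j = X $ i $ j"
    if "partial_matrix \<Delta> Y" "(matrix_poly \<Delta> Y, p) \<in> SR_rel \<Delta>" for Y i j
  proof (cases "{i, j} \<in> \<Delta>")
    case True
    have "Poly_Mapping.lookup (matrix_poly \<Delta> Y) (pair_exp i j) = Poly_Mapping.lookup p (pair_exp i j)"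
      using that(2) True unfolding SR_rel_iff[OF assms(1)] by (metis keys_pair_exp)
    moreover have "Y $ i $ j = Y $ j $ i" using that(1) by (simp add: partial_matrix_def)
    ultimately show ?thesis
      using lookup_matrix_poly_pair[OF assms(1) True, of Y] True
      by (auto simp: X_def split: if_splits)
  next
    case False
    then show ?thesis using that(1) by (simp add: X_def partial_matrix_def)
  qed
  have "(matrix_poly \<Delta> X, p) \<in> SR_rel \<Delta>"
    unfolding SR_rel_iff[OF assms(1)]
  proof (intro allI impI)
    fix m :: "'a \<Rightarrow>\<^sub>0 nat" assume m: "Poly_Mapping.keys m \<in> \<Delta>"
    show "Poly_Mapping.lookup (matrix_poly \<Delta> X) m = Poly_Mapping.lookup p m"
    proof (cases "(\<Sum>i\<in>UNIV. Poly_Mapping.lookup m i) = 2")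
      case True
      then obtain i j where ij: "m = pair_exp i j" by (rule degree_two_exponent)
      then have "{i, j} \<in> \<Delta>" using m keys_pair_exp by metis
      moreover have "X $ i $ j = X $ j $ i" using X by (simp add: partial_matrix_def)
      ultimately show ?thesis
        using lookup_matrix_poly_pair[OF assms(1), of i j X] unfolding ij by (auto simp: X_def)
    next
      case False
      then show ?thesis
        using p(1) homogeneous_matrix_poly[of \<Delta> X] unfolding homogeneous_def
        by (metis in_keys_iff)
    qed
  qed
  then show ?thesis
    using X ent unfolding iff by (intro ex1I[of _ X]) (blast, unfold vec_eq_iff, blast)
qed

end

theory Submission
  imports Defs
begin

text \<open>A form lies in \<open>K\<^sub>1\<close> iff its matrix restricts on every face to \<open>u u\<^sup>T\<close> with no \<open>u\<^sub>i\<close> zero.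
  Then \<open>X\<^sub>i\<^sub>j = \<plusminus> \<surd>(X\<^sub>i\<^sub>i X\<^sub>j\<^sub>j)\<close> on edges, and on a triangle the three signs multiply to \<open>1\<close>, so they
  form a 1-cocycle modulo 2; Hadamard products add these cocycles. A diagonal congruence changes
  the cocycle by the coboundary of the signs of the diagonal entries, and two forms whose
  cocycles are cohomologous are congruent after rescaling the diagonals. Conversely a
  cocycle \<open>f\<close> gives the matrix \<open>(-1)\<^bsup>f(ij)\<^esup>\<close>, which on a face containing \<open>a\<close> is \<open>u u\<^sup>T\<close> for
  \<open>u\<^sub>i = (-1)\<^bsup>f(ia)\<^esup>\<close>.\<close>

section \<open>Quadratic forms and their matrices\<close>

lemma finite_complex_subface: "finite_complex \<Delta> \<Longrightarrow> F \<in> \<Delta> \<Longrightarrow> G \<subseteq> F \<Longrightarrow> G \<in> \<Delta>"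
  by (simp add: finite_complex_def)

text \<open>Exponents outside the support have coefficient 0. Summing two polynomials over a common
  index set makes additivity of evaluation a termwise identity.\<close>

lemma poly_eval_superset:
  assumes "finite K" "Poly_Mapping.keys p \<subseteq> K"
  shows "poly_eval p x = (\<Sum>m\<in>K. Poly_Mapping.lookup p m * (\<Prod>i\<in>UNIV. (x $ i) ^ Poly_Mapping.lookup m i))"
  unfolding poly_eval_def
  by (rule sum.mono_neutral_left) (use assms in \<open>auto simp: in_keys_iff\<close>)

lemma poly_eval_zero [simp]: "poly_eval 0 x = 0"
  by (simp add: poly_eval_def)

lemma poly_eval_add: "poly_eval (p + r) x = poly_eval p x + poly_eval r x"
proof -
  let ?K = "Poly_Mapping.keys p \<union> Poly_Mapping.keys r"
  have "finite ?K" "Poly_Mapping.keys (p + r) \<subseteq> ?K"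
    using keys_add[of p r] by auto
  then show ?thesis
    using poly_eval_superset[of ?K p x] poly_eval_superset[of ?K r x] poly_eval_superset[of ?K "p + r" x]
    by (simp add: lookup_add distrib_right sum.distrib)
qed

lemma poly_eval_sum: "poly_eval (\<Sum>a\<in>A. p a) x = (\<Sum>a\<in>A. poly_eval (p a) x)"
  by (induction A rule: infinite_finite_induct) (auto simp: poly_eval_add)

lemma poly_eval_single_pair_exp:
  "poly_eval (Poly_Mapping.single (pair_exp i j) c) x = c * x $ i * x $ j"
proof -
  have one: "(\<Prod>k\<in>UNIV. (x $ k) ^ Poly_Mapping.lookup (Poly_Mapping.single i (1::nat)) k) = x $ i" for i
  proof -
    have "(\<Prod>k\<in>UNIV. (x $ k) ^ Poly_Mapping.lookup (Poly_Mapping.single i (1::nat)) k)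
      = (\<Prod>k\<in>UNIV. if k = i then x $ k else 1)"
      by (rule prod.cong) (auto simp: lookup_single when_def)
    then show ?thesis by simp
  qed
  have "poly_eval (Poly_Mapping.single (pair_exp i j) c) x =
    c * (\<Prod>k\<in>UNIV. (x $ k) ^ Poly_Mapping.lookup (pair_exp i j) k)"
    by (subst poly_eval_superset[of "{pair_exp i j}"]) auto
  also have "(\<Prod>k\<in>UNIV. (x $ k) ^ Poly_Mapping.lookup (pair_exp i j) k) = x $ i * x $ j"
    unfolding lookup_add power_add prod.distrib one ..
  finally show ?thesis by simp
qed

text \<open>Since unspecified entries are stored as 0, the sum over edges extends to all ordered
  pairs, which yields the ordinary quadratic form of a full symmetric matrix.\<close>

lemma matrix_poly_eq_sum:
  assumes "partial_matrix \<Delta> X"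
  shows "matrix_poly \<Delta> X = (\<Sum>i\<in>UNIV. \<Sum>j\<in>UNIV. Poly_Mapping.single (pair_exp i j) (X $ i $ j))"
proof -
  let ?s = "\<lambda>i j. Poly_Mapping.single (pair_exp i j) (X $ i $ j)"
  have m: "const c * var i * var j = Poly_Mapping.single (pair_exp i j) c" for c and i j :: 'a
    by (simp add: const_def var_def mult_single)
  then have m2: "const c * var i ^ 2 = Poly_Mapping.single (pair_exp i i) c" for c and i :: 'a
    by (simp add: power2_eq_square mult.assoc)
  have "(\<Sum>(i, j) | i \<noteq> j \<and> {i, j} \<in> \<Delta>. ?s i j) = (\<Sum>(i, j)\<in>UNIV. if i \<noteq> j then ?s i j else 0)"
    by (rule sum.mono_neutral_cong_left)
       (use assms in \<open>auto simp: partial_matrix_def split: if_splits\<close>, metis single_zero)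
  also have "\<dots> = (\<Sum>i\<in>UNIV. \<Sum>j\<in>UNIV. if i \<noteq> j then ?s i j else 0)"
    by (simp add: sum.cartesian_product)
  finally have "matrix_poly \<Delta> X = (\<Sum>i\<in>UNIV. ?s i i + (\<Sum>j\<in>UNIV. if i \<noteq> j then ?s i j else 0))"
    unfolding matrix_poly_def m m2 by (simp add: sum.distrib)
  also have "\<dots> = (\<Sum>i\<in>UNIV. \<Sum>j\<in>UNIV. ?s i j)"
  proof (rule sum.cong[OF refl])
    fix i
    have "(\<Sum>j\<in>UNIV. if i \<noteq> j then ?s i j else 0) = (\<Sum>j\<in>UNIV - {i}. ?s i j)"
      by (rule sum.mono_neutral_cong_right) auto
    then show "?s i i + (\<Sum>j\<in>UNIV. if i \<noteq> j then ?s i j else 0) = (\<Sum>j\<in>UNIV. ?s i j)"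
      by (simp add: sum.remove[of UNIV i])
  qed
  finally show ?thesis .
qed

lemma poly_eval_matrix_poly:
  assumes "partial_matrix \<Delta> X"
  shows "poly_eval (matrix_poly \<Delta> X) x = (\<Sum>i\<in>UNIV. \<Sum>j\<in>UNIV. X $ i $ j * x $ i * x $ j)"
  unfolding matrix_poly_eq_sum[OF assms] poly_eval_sum poly_eval_single_pair_exp ..

text \<open>Together with the next lemma this makes \<open>form_of\<close> and
  \<open>form_matrix\<close> inverse bijections between partial matrices and
  \<open>R2 \<Delta>\<close>, so forms can be replaced by their matrices.\<close>

lemma form_matrix_form_of:
  assumes "finite_complex \<Delta>" "partial_matrix \<Delta> X"
  shows "form_matrix \<Delta> (form_of \<Delta> X) = X"
  unfolding form_matrix_def
  by (rule the1_equality[OF form_matrix_unique[OF assms(1) form_of_in_R2]]) (simp add: assms)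

lemma
  assumes "finite_complex \<Delta>" "q \<in> R2 \<Delta>"
  shows partial_matrix_form_matrix: "partial_matrix \<Delta> (form_matrix \<Delta> q)"
    and form_of_form_matrix: "form_of \<Delta> (form_matrix \<Delta> q) = q"
  using theI'[OF form_matrix_unique[OF assms]] unfolding form_matrix_def by auto

lemma form_value_eq:
  assumes "finite_complex \<Delta>" "q \<in> R2 \<Delta>" "x \<in> support_union \<Delta>"
  shows "form_value q x = (\<Sum>i\<in>UNIV. \<Sum>j\<in>UNIV. form_matrix \<Delta> q $ i $ j * x $ i * x $ j)"
proof -
  have "form_value q x = form_value (form_of \<Delta> (form_matrix \<Delta> q)) x"
    by (simp add: form_of_form_matrix[OF assms(1,2)])
  also have "\<dots> = poly_eval (matrix_poly \<Delta> (form_matrix \<Delta> q)) x"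
    unfolding form_of_def by (rule form_value_coset[OF assms(1,3)])
  also have "\<dots> = (\<Sum>i\<in>UNIV. \<Sum>j\<in>UNIV. form_matrix \<Delta> q $ i $ j * x $ i * x $ j)"
    by (rule poly_eval_matrix_poly[OF partial_matrix_form_matrix[OF assms(1,2)]])
  finally show ?thesis .
qed

text \<open>Turns full support into positivity of the diagonal.\<close>

lemma form_value_axis:
  assumes "finite_complex \<Delta>" "q \<in> R2 \<Delta>"
  shows "form_value q (axis i 1) = form_matrix \<Delta> q $ i $ i"
proof -
  have "axis i 1 \<in> support_union \<Delta>"
    using assms(1) unfolding support_union_def finite_complex_def
    by (intro UN_I[of "{i}"] span_base) auto
  moreover have "(\<Sum>k\<in>UNIV. \<Sum>j\<in>UNIV. X $ k $ j * axis i 1 $ k * axis i 1 $ j) = X $ i $ i"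
    for X :: "real ^ 'a ^ 'a"
    by (simp add: axis_def if_distrib[of "\<lambda>t. _ * t"] if_distrib[of "\<lambda>t. t * _"] cong: if_cong)
  ultimately show ?thesis
    using form_value_eq[OF assms] by simp
qed

section \<open>Matrices of rank one on every face\<close>

text \<open>The factorization \<open>u u^T\<close> with nonvanishing \<open>u\<close> encodes at
  once that the submatrix is positive semidefinite, has rank at most one and has positive diagonal.
  The empty face satisfies it vacuously.\<close>

definition rank_one_on :: "'v set \<Rightarrow> real ^ 'v ^ 'v \<Rightarrow> bool" where
  "rank_one_on F X \<longleftrightarrow> (\<exists>u. \<forall>i\<in>F. u i \<noteq> 0 \<and> (\<forall>j\<in>F. X $ i $ j = u i * u j))"

text \<open>The set of forms whose congruence classes make up \<open>K1 \<Delta>\<close>.\<close>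

definition rank_one_forms :: "'v::finite set set \<Rightarrow> 'v rpoly set set" where
  "rank_one_forms \<Delta> = {q \<in> Pcone \<Delta>. full_support q \<and> local_rank \<Delta> q = 1}"

text \<open>A nonzero row \<open>a\<close> spans the row space. By symmetry the multipliers of the
  rows, scaled by the square root of the positive entry at \<open>(a, a)\<close>, form the vector
  \<open>u\<close>.\<close>

lemma rank_one_onI_rank_le_1:
  fixes X :: "real ^ 'v::finite ^ 'v"
  assumes sym: "\<And>i j. X $ i $ j = X $ j $ i" and pos: "\<And>i. X $ i $ i > 0"
    and rank: "rank (face_submatrix X F) \<le> 1"
  shows "rank_one_on F X"
proof (cases "F = {}")
  case True
  then show ?thesis by (simp add: rank_one_on_def)
next
  case False
  then obtain a where a: "a \<in> F" by blast
  let ?r = "\<lambda>i. row i (face_submatrix X F)"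
  have entry: "?r i $ j = X $ i $ j" if "i \<in> F" "j \<in> F" for i j
    using that by (simp add: row_def face_submatrix_def)
  have ra: "?r a \<noteq> 0"
    using entry[OF a a] pos[of a] by auto
  \<comment> \<open>A row outside the line through row \<open>a\<close> would give two independent
    rows, hence rank at least 2.\<close>
  have "\<exists>c. ?r i = c *\<^sub>R ?r a" for i
  proof (rule ccontr)
    assume "\<nexists>c. ?r i = c *\<^sub>R ?r a"
    then have "?r i \<notin> span {?r a}" by (auto simp: span_singleton)
    then have "dim {?r i, ?r a} = 2"
      using ra by (simp add: dim_insert)
    moreover have "{?r i, ?r a} \<subseteq> rows (face_submatrix X F)"
      by (auto simp: rows_def)
    ultimately show False
      using dim_subset[of "{?r i, ?r a}" "rows (face_submatrix X F)"] rank
      by (simp add: row_rank_def)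
  qed
  then obtain c where c: "\<And>i. ?r i = c i *\<^sub>R ?r a" by metis
  have ca: "X $ i $ j = c i * X $ a $ j" if "i \<in> F" "j \<in> F" for i j
    using arg_cong[OF c[of i], of "\<lambda>w. w $ j"] that a by (simp add: entry)
  \<comment> \<open>By \<open>ca\<close> and symmetry, the entry at \<open>(i, j)\<close> is
    \<open>c i\<close> times the entry at \<open>(j, a)\<close>, that is \<open>c i * c j\<close>
    times the entry at \<open>(a, a)\<close>, which is then split into two square roots.\<close>
  have X: "X $ i $ j = c i * sqrt (X $ a $ a) * (c j * sqrt (X $ a $ a))" if "i \<in> F" "j \<in> F" for i j
    using ca[OF that] ca[OF that(2) a] sym[of a j] pos[of a]
      real_sqrt_mult_self[of "X $ a $ a"] by (simp add: algebra_simps)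
  show ?thesis
    unfolding rank_one_on_def
  proof (intro exI[of _ "\<lambda>i. c i * sqrt (X $ a $ a)"] ballI conjI)
    fix i assume "i \<in> F"
    then show "c i * sqrt (X $ a $ a) \<noteq> 0" using X[of i i] pos[of i] by auto
  qed (use X in blast)
qed

text \<open>All rows are multiples of the zero-padded vector \<open>w\<close>. Only an upper bound
  is possible here, since the empty face has rank 0.\<close>

lemma rank_face_submatrix_le_1:
  assumes "rank_one_on F X"
  shows "rank (face_submatrix X F) \<le> 1"
proof -
  obtain u where u: "\<And>i j. i \<in> F \<Longrightarrow> j \<in> F \<Longrightarrow> X $ i $ j = u i * u j"
    using assms by (auto simp: rank_one_on_def)
  define w where "w = (\<chi> j. if j \<in> F then u j else 0)"
  have "row i (face_submatrix X F) = (if i \<in> F then u i else 0) *\<^sub>R w" for i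
    by (auto simp: vec_eq_iff row_def face_submatrix_def w_def u)
  then have "rows (face_submatrix X F) \<subseteq> span {w}"
    by (auto simp: rows_def span_singleton)
  then have "dim (rows (face_submatrix X F)) \<le> card {w}"
    by (intro dim_le_card) auto
  then show ?thesis by (simp add: row_rank_def)
qed

lemma rank_one_on_diag_pos:
  assumes "rank_one_on F X" "i \<in> F"
  shows "X $ i $ i > 0"
  using assms unfolding rank_one_on_def by (metis not_real_square_gt_zero)

text \<open>Terms with a vanishing coordinate of \<open>x\<close> contribute 0, so the factorization
  on the support of \<open>x\<close> suffices to write the value as a square.\<close>

lemma rank_one_on_nonneg:
  fixes x :: "real ^ 'v::finite"
  assumes "rank_one_on {i. x $ i \<noteq> 0} X"
  shows "(\<Sum>i\<in>UNIV. \<Sum>j\<in>UNIV. X $ i $ j * x $ i * x $ j) \<ge> 0"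
proof -
  obtain u where u: "\<And>i j. x $ i \<noteq> 0 \<Longrightarrow> x $ j \<noteq> 0 \<Longrightarrow> X $ i $ j = u i * u j"
    using assms by (auto simp: rank_one_on_def)
  have "(\<Sum>i\<in>UNIV. \<Sum>j\<in>UNIV. X $ i $ j * x $ i * x $ j)
    = (\<Sum>i\<in>UNIV. \<Sum>j\<in>UNIV. (u i * x $ i) * (u j * x $ j))"
    by (intro sum.cong refl) (metis (no_types, opaque_lifting) u mult_zero_left mult_zero_right mult.assoc mult.commute)
  also have "\<dots> = (\<Sum>i\<in>UNIV. u i * x $ i)\<^sup>2"
    by (simp add: power2_eq_square sum_product)
  finally show ?thesis by simp
qed

text \<open>Replaces cone membership, full support and local rank by one condition on each face. For
  the converse, a point of \<open>support_union \<Delta>\<close> has a face as its support, so the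
  form takes a square as its value there.\<close>

lemma rank_one_forms_iff:
  assumes "finite_complex \<Delta>"
  shows "q \<in> rank_one_forms \<Delta> \<longleftrightarrow> q \<in> R2 \<Delta> \<and> (\<forall>F\<in>\<Delta>. rank_one_on F (form_matrix \<Delta> q))"
proof
  let ?X = "form_matrix \<Delta> q"
  assume q: "q \<in> rank_one_forms \<Delta>"
  then have R: "q \<in> R2 \<Delta>" by (simp add: rank_one_forms_def Pcone_def)
  have "rank_one_on F ?X" if "F \<in> \<Delta>" for F
  proof (rule rank_one_onI_rank_le_1)
    show "?X $ i $ j = ?X $ j $ i" for i j
      using partial_matrix_form_matrix[OF assms R] by (simp add: partial_matrix_def)
    show "?X $ i $ i > 0" for i
      using q form_value_axis[OF assms R] by (simp add: rank_one_forms_def full_support_def)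
    show "rank (face_submatrix ?X F) \<le> 1"
      using q that Max_ge[of "(\<lambda>F. rank (face_submatrix ?X F)) ` \<Delta>"]
      by (auto simp: rank_one_forms_def local_rank_def)
  qed
  then show "q \<in> R2 \<Delta> \<and> (\<forall>F\<in>\<Delta>. rank_one_on F ?X)" using R by blast
next
  let ?X = "form_matrix \<Delta> q"
  assume q: "q \<in> R2 \<Delta> \<and> (\<forall>F\<in>\<Delta>. rank_one_on F ?X)"
  have vert: "{i} \<in> \<Delta>" for i using assms by (simp add: finite_complex_def)
  have pos: "?X $ i $ i > 0" for i
    using rank_one_on_diag_pos[of "{i}"] q vert by blast
  have "form_value q x \<ge> 0" if "x \<in> support_union \<Delta>" for x
    unfolding form_value_eq[OF assms conjunct1[OF q] that]
    using q support_union_iff[OF that assms] by (intro rank_one_on_nonneg) blast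
  then have "q \<in> Pcone \<Delta>" using q by (simp add: Pcone_def)
  moreover have "full_support q"
    using pos form_value_axis[OF assms] q by (simp add: full_support_def)
  moreover have "local_rank \<Delta> q = 1"
    unfolding local_rank_def
  proof (rule Max_eqI)
    fix n assume "n \<in> (\<lambda>F. rank (face_submatrix ?X F)) ` \<Delta>"
    then show "n \<le> 1" using q rank_face_submatrix_le_1 by blast
  next
    \<comment> \<open>The maximal rank is attained at every vertex \<open>a\<close>, whose 1 by 1
      submatrix is positive; a vertex exists because types are nonempty.\<close>
    fix a :: 'a
    have "face_submatrix ?X {a} $ a $ a \<noteq> 0" using pos[of a] by (simp add: face_submatrix_def)
    then have "rank (face_submatrix ?X {a}) \<noteq> 0" unfolding rank_eq_0 by auto
    then have "rank (face_submatrix ?X {a}) = 1"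
      using q vert[of a] rank_face_submatrix_le_1 by fastforce
    then show "1 \<in> (\<lambda>F. rank (face_submatrix ?X F)) ` \<Delta>" using vert[of a] by (metis imageI)
  qed simp
  ultimately show "q \<in> rank_one_forms \<Delta>" by (simp add: rank_one_forms_def)
qed

lemma rank_one_forms_in_R2: "q \<in> rank_one_forms \<Delta> \<Longrightarrow> q \<in> R2 \<Delta>"
  by (simp add: rank_one_forms_def Pcone_def)

lemma rank_one_forms_faceE:
  assumes "finite_complex \<Delta>" "q \<in> rank_one_forms \<Delta>" "F \<in> \<Delta>"
  obtains u where "\<And>i. i \<in> F \<Longrightarrow> u i \<noteq> 0"
    "\<And>i j. i \<in> F \<Longrightarrow> j \<in> F \<Longrightarrow> form_matrix \<Delta> q $ i $ j = u i * u j"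
proof -
  have "rank_one_on F (form_matrix \<Delta> q)"
    using assms(2,3) by (simp add: rank_one_forms_iff[OF assms(1)])
  then show ?thesis using that unfolding rank_one_on_def by metis
qed

lemma form_of_in_rank_one_forms:
  assumes "finite_complex \<Delta>" "partial_matrix \<Delta> X" "\<And>F. F \<in> \<Delta> \<Longrightarrow> rank_one_on F X"
  shows "form_of \<Delta> X \<in> rank_one_forms \<Delta>"
  by (simp add: rank_one_forms_iff[OF assms(1)] form_of_in_R2 form_matrix_form_of[OF assms(1,2)] assms(3))

lemma form_matrix_hadamard:
  assumes "finite_complex \<Delta>" "q \<in> R2 \<Delta>" "r \<in> R2 \<Delta>"
  shows "form_matrix \<Delta> (hadamard \<Delta> q r) = (\<chi> i j. form_matrix \<Delta> q $ i $ j * form_matrix \<Delta> r $ i $ j)"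
  unfolding hadamard_def
  using partial_matrix_form_matrix[OF assms(1,2)] partial_matrix_form_matrix[OF assms(1,3)]
  by (intro form_matrix_form_of[OF assms(1)]) (auto simp: partial_matrix_def)

text \<open>On a face, the entrywise product of \<open>u u^T\<close> and \<open>v v^T\<close> is
  \<open>w w^T\<close> with \<open>w\<close> the entrywise product of \<open>u\<close> and
  \<open>v\<close>.\<close>

lemma hadamard_in_rank_one_forms:
  assumes "finite_complex \<Delta>" "q \<in> rank_one_forms \<Delta>" "r \<in> rank_one_forms \<Delta>"
  shows "hadamard \<Delta> q r \<in> rank_one_forms \<Delta>"
proof -
  have R: "q \<in> R2 \<Delta>" "r \<in> R2 \<Delta>" using assms by (auto intro: rank_one_forms_in_R2)
  have "rank_one_on F (form_matrix \<Delta> (hadamard \<Delta> q r))" if F: "F \<in> \<Delta>" for F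
  proof -
    obtain u where u: "\<And>i. i \<in> F \<Longrightarrow> u i \<noteq> 0"
      "\<And>i j. i \<in> F \<Longrightarrow> j \<in> F \<Longrightarrow> form_matrix \<Delta> q $ i $ j = u i * u j"
      by (rule rank_one_forms_faceE[OF assms(1,2) F]) blast
    obtain v where v: "\<And>i. i \<in> F \<Longrightarrow> v i \<noteq> 0"
      "\<And>i j. i \<in> F \<Longrightarrow> j \<in> F \<Longrightarrow> form_matrix \<Delta> r $ i $ j = v i * v j"
      by (rule rank_one_forms_faceE[OF assms(1,3) F]) blast
    show ?thesis
      unfolding rank_one_on_def form_matrix_hadamard[OF assms(1) R]
      by (intro exI[of _ "\<lambda>i. u i * v i"]) (simp add: u v)
  qed
  moreover have "hadamard \<Delta> q r \<in> R2 \<Delta>" by (simp add: hadamard_def form_of_in_R2)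
  ultimately show ?thesis by (simp add: rank_one_forms_iff[OF assms(1)])
qed

section \<open>Diagonal congruence\<close>

text \<open>Trades the matrix \<open>D\<close> for the function \<open>d\<close> on its diagonal:
  the determinant of a diagonal matrix is the product of its diagonal entries, so invertibility
  means that none is zero.\<close>

lemma diag_cong_iff:
  "(q, r) \<in> diag_cong \<Delta> \<longleftrightarrow> q \<in> R2 \<Delta> \<and> r \<in> R2 \<Delta> \<and> (\<exists>d. (\<forall>i. d i \<noteq> 0) \<and>
     (\<forall>i j. {i, j} \<in> \<Delta> \<longrightarrow> form_matrix \<Delta> r $ i $ j = d i * d j * form_matrix \<Delta> q $ i $ j))"
  (is "_ \<longleftrightarrow> _ \<and> _ \<and> (\<exists>d. ?P d)")
proof -
  have nz: "invertible D \<longleftrightarrow> (\<forall>i. D $ i $ i \<noteq> 0)"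
    if "\<forall>i j. i \<noteq> j \<longrightarrow> D $ i $ j = 0" for D :: "real ^ 'a ^ 'a"
    using that by (simp add: invertible_det_nz det_diagonal)
  have "(\<exists>D :: real ^ 'a ^ 'a. invertible D \<and> (\<forall>i j. i \<noteq> j \<longrightarrow> D $ i $ j = 0) \<and>
        (\<forall>i j. {i, j} \<in> \<Delta> \<longrightarrow>
           form_matrix \<Delta> r $ i $ j = D $ i $ i * D $ j $ j * form_matrix \<Delta> q $ i $ j)) \<longleftrightarrow> (\<exists>d. ?P d)"
  proof
    assume "\<exists>d. ?P d"
    then obtain d where d: "?P d" by blast
    define D :: "real ^ 'a ^ 'a" where "D = (\<chi> i j. if i = j then d i else 0)"
    have off: "\<forall>i j. i \<noteq> j \<longrightarrow> D $ i $ j = 0" and dia: "D $ i $ i = d i" for i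
      by (auto simp: D_def)
    show "\<exists>D :: real ^ 'a ^ 'a. invertible D \<and> (\<forall>i j. i \<noteq> j \<longrightarrow> D $ i $ j = 0) \<and>
        (\<forall>i j. {i, j} \<in> \<Delta> \<longrightarrow>
           form_matrix \<Delta> r $ i $ j = D $ i $ i * D $ j $ j * form_matrix \<Delta> q $ i $ j)"
      by (intro exI[of _ D] conjI) (use off d in \<open>auto simp: nz[OF off] dia\<close>)
  next
    assume "\<exists>D :: real ^ 'a ^ 'a. invertible D \<and> (\<forall>i j. i \<noteq> j \<longrightarrow> D $ i $ j = 0) \<and>
        (\<forall>i j. {i, j} \<in> \<Delta> \<longrightarrow>
           form_matrix \<Delta> r $ i $ j = D $ i $ i * D $ j $ j * form_matrix \<Delta> q $ i $ j)"
    then obtain D :: "real ^ 'a ^ 'a" where D: "invertible D" "\<forall>i j. i \<noteq> j \<longrightarrow> D $ i $ j = 0"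
      "\<forall>i j. {i, j} \<in> \<Delta> \<longrightarrow>
           form_matrix \<Delta> r $ i $ j = D $ i $ i * D $ j $ j * form_matrix \<Delta> q $ i $ j" by (elim exE conjE)
    show "\<exists>d. ?P d"
      by (rule exI[of _ "\<lambda>i. D $ i $ i"]) (use D(1,3) nz[OF D(2)] in simp)
  qed
  then show ?thesis unfolding diag_cong_def by simp
qed

lemma diag_congI:
  assumes "q \<in> R2 \<Delta>" "r \<in> R2 \<Delta>" "\<And>i. d i \<noteq> 0"
    "\<And>i j. {i, j} \<in> \<Delta> \<Longrightarrow> form_matrix \<Delta> r $ i $ j = d i * d j * form_matrix \<Delta> q $ i $ j"
  shows "(q, r) \<in> diag_cong \<Delta>"
  unfolding diag_cong_iff using assms by blast

lemma diag_congE: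
  assumes "(q, r) \<in> diag_cong \<Delta>"
  obtains d where "q \<in> R2 \<Delta>" "r \<in> R2 \<Delta>" "\<And>i. d i \<noteq> 0"
    "\<And>i j. {i, j} \<in> \<Delta> \<Longrightarrow> form_matrix \<Delta> r $ i $ j = d i * d j * form_matrix \<Delta> q $ i $ j"
  using assms unfolding diag_cong_iff by blast

lemma equiv_diag_cong: "equiv (R2 \<Delta>) (diag_cong \<Delta>)"
proof (rule equivI)
  show "diag_cong \<Delta> \<subseteq> R2 \<Delta> \<times> R2 \<Delta>" by (auto simp: diag_cong_def)
  show "refl_on (R2 \<Delta>) (diag_cong \<Delta>)"
    by (auto simp: refl_on_def intro: diag_congI[where d = "\<lambda>_. 1"])
  show "sym (diag_cong \<Delta>)"
  proof (rule symI)
    fix q r assume "(q, r) \<in> diag_cong \<Delta>"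
    then obtain d where "q \<in> R2 \<Delta>" "r \<in> R2 \<Delta>" "\<And>i. d i \<noteq> 0"
      "\<And>i j. {i, j} \<in> \<Delta> \<Longrightarrow> form_matrix \<Delta> r $ i $ j = d i * d j * form_matrix \<Delta> q $ i $ j"
      by (rule diag_congE) blast
    then show "(r, q) \<in> diag_cong \<Delta>"
      by (intro diag_congI[where d = "\<lambda>i. inverse (d i)"]) (auto simp: field_simps)
  qed
  show "trans (diag_cong \<Delta>)"
  proof (rule transI)
    fix q r s assume qr: "(q, r) \<in> diag_cong \<Delta>" and rs: "(r, s) \<in> diag_cong \<Delta>"
    obtain d where d: "q \<in> R2 \<Delta>" "\<And>i. d i \<noteq> 0"
      "\<And>i j. {i, j} \<in> \<Delta> \<Longrightarrow> form_matrix \<Delta> r $ i $ j = d i * d j * form_matrix \<Delta> q $ i $ j"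
      using qr by (rule diag_congE) blast
    obtain e where e: "s \<in> R2 \<Delta>" "\<And>i. e i \<noteq> 0"
      "\<And>i j. {i, j} \<in> \<Delta> \<Longrightarrow> form_matrix \<Delta> s $ i $ j = e i * e j * form_matrix \<Delta> r $ i $ j"
      using rs by (rule diag_congE) blast
    show "(q, s) \<in> diag_cong \<Delta>"
      by (rule diag_congI[where d = "\<lambda>i. d i * e i"]) (use d e in \<open>auto simp: algebra_simps\<close>)
  qed
qed

lemma hadamard_diag_cong:
  assumes "finite_complex \<Delta>" "(q, q') \<in> diag_cong \<Delta>" "(r, r') \<in> diag_cong \<Delta>"
  shows "(hadamard \<Delta> q r, hadamard \<Delta> q' r') \<in> diag_cong \<Delta>"
proof -
  obtain d where d: "q \<in> R2 \<Delta>" "q' \<in> R2 \<Delta>" "\<And>i. d i \<noteq> 0"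
    "\<And>i j. {i, j} \<in> \<Delta> \<Longrightarrow> form_matrix \<Delta> q' $ i $ j = d i * d j * form_matrix \<Delta> q $ i $ j"
    using assms(2) by (rule diag_congE) blast
  obtain e where e: "r \<in> R2 \<Delta>" "r' \<in> R2 \<Delta>" "\<And>i. e i \<noteq> 0"
    "\<And>i j. {i, j} \<in> \<Delta> \<Longrightarrow> form_matrix \<Delta> r' $ i $ j = e i * e j * form_matrix \<Delta> r $ i $ j"
    using assms(3) by (rule diag_congE) blast
  show ?thesis
  proof (rule diag_congI)
    show "hadamard \<Delta> q r \<in> R2 \<Delta>" "hadamard \<Delta> q' r' \<in> R2 \<Delta>"
      by (simp_all add: hadamard_def form_of_in_R2)
    show "d i * e i \<noteq> 0" for i using d(3) e(3) by simp
    fix i j assume "{i, j} \<in> \<Delta>"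
    then show "form_matrix \<Delta> (hadamard \<Delta> q' r') $ i $ j =
      (d i * e i) * (d j * e j) * form_matrix \<Delta> (hadamard \<Delta> q r) $ i $ j"
      by (simp add: form_matrix_hadamard[OF assms(1)] d e)
  qed
qed

text \<open>The Hadamard product respects congruence in both arguments, so the union that defines
  \<open>class_prod\<close> collapses to one class.\<close>

lemma class_prod_class:
  assumes "finite_complex \<Delta>" "q \<in> R2 \<Delta>" "r \<in> R2 \<Delta>"
  shows "class_prod \<Delta> (diag_cong \<Delta> `` {q}) (diag_cong \<Delta> `` {r}) = diag_cong \<Delta> `` {hadamard \<Delta> q r}"
  unfolding class_prod_def
proof (rule UN_equiv_class2[OF equiv_diag_cong equiv_diag_cong _ assms(2,3)])
  show "(\<lambda>q r. diag_cong \<Delta> `` {hadamard \<Delta> q r}) respects2 diag_cong \<Delta>"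
    using hadamard_diag_cong[OF assms(1)] equiv_class_eq[OF equiv_diag_cong]
    by (intro congruent2I') blast
qed

text \<open>Congruence is a relation on all of \<open>R2 \<Delta>\<close>; this invariance ensures
  that the class of a rank one form contains nothing but rank one forms. The factor \<open>u\<close>
  is rescaled by \<open>d\<close>.\<close>

lemma rank_one_forms_diag_cong:
  assumes "finite_complex \<Delta>" "q \<in> rank_one_forms \<Delta>" "(q, r) \<in> diag_cong \<Delta>"
  shows "r \<in> rank_one_forms \<Delta>"
proof -
  obtain d where d: "r \<in> R2 \<Delta>" "\<And>i. d i \<noteq> 0"
    "\<And>i j. {i, j} \<in> \<Delta> \<Longrightarrow> form_matrix \<Delta> r $ i $ j = d i * d j * form_matrix \<Delta> q $ i $ j"
    using assms(3) by (rule diag_congE) blast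
  have "rank_one_on F (form_matrix \<Delta> r)" if F: "F \<in> \<Delta>" for F
  proof -
    obtain u where u: "\<And>i. i \<in> F \<Longrightarrow> u i \<noteq> 0"
      "\<And>i j. i \<in> F \<Longrightarrow> j \<in> F \<Longrightarrow> form_matrix \<Delta> q $ i $ j = u i * u j"
      by (rule rank_one_forms_faceE[OF assms(1,2) F]) blast
    have "{i, j} \<in> \<Delta>" if "i \<in> F" "j \<in> F" for i j
      by (rule finite_complex_subface[OF assms(1) F]) (use that in simp)
    then show ?thesis
      unfolding rank_one_on_def by (intro exI[of _ "\<lambda>i. d i * u i"]) (simp add: u d)
  qed
  then show ?thesis using d(1) by (simp add: rank_one_forms_iff[OF assms(1)])
qed

section \<open>Sign cochains\<close>

text \<open>The isomorphism from the additive group of two elements onto the signs 1 and -1, taken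
  as reals so that its values compare with \<open>sgn\<close>.\<close>

definition sign_of_bit :: "bit \<Rightarrow> real" where
  "sign_of_bit b = (if b = 0 then 1 else - 1)"

lemma sign_of_bit_0 [simp]: "sign_of_bit 0 = 1"
  and sign_of_bit_1 [simp]: "sign_of_bit 1 = - 1"
  by (auto simp: sign_of_bit_def)

lemma sign_of_bit_add: "sign_of_bit (a + b) = sign_of_bit a * sign_of_bit b"
  by (cases a; cases b) auto

lemma sign_of_bit_eq_iff [simp]: "sign_of_bit a = sign_of_bit b \<longleftrightarrow> a = b"
  by (cases a; cases b) auto

lemma sign_of_bit_nonzero [simp]: "sign_of_bit a \<noteq> 0"
  by (cases a) auto

lemma sgn_sign_of_bit [simp]: "sgn (sign_of_bit a) = sign_of_bit a"
  by (cases a) auto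

lemma bit_add_self: "(a::bit) + a = 0"
  by (cases a) auto

section \<open>Cochains in degrees 0 and 1\<close>

lemma cochains_1_singleton:
  assumes "f \<in> cochains \<Delta> 1"
  shows "f {i} = 0"
  using assms by (simp add: cochains_def)

text \<open>1-cochains vanish off the edges, and every edge is a pair. The degenerate case
  \<open>i = j\<close> stays in the hypothesis because the formulas used to verify it hold for
  singletons as well.\<close>

lemma cochains_1_eqI:
  assumes "f \<in> cochains \<Delta> 1" "g \<in> cochains \<Delta> 1"
    and "\<And>i j. {i, j} \<in> \<Delta> \<Longrightarrow> f {i, j} = g {i, j}"
  shows "f = g"
proof
  fix F
  show "f F = g F"
  proof (cases "F \<in> \<Delta> \<and> card F = 2")
    case True
    then show ?thesis using assms(3) by (metis card_2_iff)
  next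
    case False
    then show ?thesis using assms(1,2) by (simp add: cochains_def numeral_2_eq_2)
  qed
qed

text \<open>For \<open>i = j\<close> the left side is 0 because the cardinality is 1 instead of 2,
  and the right side is 0 in characteristic 2. Later computations thus need no case split.\<close>

lemma coboundary_0_pair:
  assumes "{i, j} \<in> \<Delta>"
  shows "coboundary \<Delta> 0 h {i, j} = h {i} + h {j}"
proof (cases "i = j")
  case True
  then show ?thesis by (simp add: coboundary_def bit_add_self del: add_bit_eq_xor)
next
  case False
  then have "{i, j} - {i} = {j}" "{i, j} - {j} = {i}" by auto
  then show ?thesis using False assms
    by (simp add: coboundary_def add.commute del: add_bit_eq_xor)
qed

lemma coboundary_0_in_cochains: "coboundary \<Delta> 0 h \<in> cochains \<Delta> 1"
  by (auto simp: coboundary_def cochains_def)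

text \<open>On a genuine triangle this is the usual condition, solved for one edge modulo 2. Triples
  with repetitions impose nothing new.\<close>

lemma cocycle_iff:
  assumes "f \<in> cochains \<Delta> 1"
  shows "coboundary \<Delta> 1 f = (\<lambda>_. 0) \<longleftrightarrow>
    (\<forall>i j k. {i, j, k} \<in> \<Delta> \<longrightarrow> f {i, k} = f {i, j} + f {j, k})"
    (is "?L \<longleftrightarrow> ?R")
proof -
  have tri: "coboundary \<Delta> 1 f {i, j, k} = f {j, k} + (f {i, k} + f {i, j})"
    if "{i, j, k} \<in> \<Delta>" "i \<noteq> j" "j \<noteq> k" "i \<noteq> k" for i j k
  proof -
    have "{i, j, k} - {i} = {j, k}" "{i, j, k} - {j} = {i, k}" "{i, j, k} - {k} = {i, j}"
      using that by auto
    then show ?thesis using that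
      by (simp add: coboundary_def card_insert_if del: add_bit_eq_xor)
  qed
  have arith: "a + (b + c) = 0 \<longleftrightarrow> b = c + a" for a b c :: bit
    by (cases a; cases b; cases c) auto
  show ?thesis
  proof
    assume ?L
    show ?R
    proof (intro allI impI)
      fix i j k assume ijk: "{i, j, k} \<in> \<Delta>"
      show "f {i, k} = f {i, j} + f {j, k}"
      proof (cases "i \<noteq> j \<and> j \<noteq> k \<and> i \<noteq> k")
        case True
        then have "f {j, k} + (f {i, k} + f {i, j}) = 0"
          using \<open>?L\<close> tri[OF ijk] by simp
        then show ?thesis by (simp only: arith)
      next
        \<comment> \<open>If \<open>i = j\<close> or \<open>j = k\<close>, one summand is a value on
          a singleton, hence 0. If \<open>i = k\<close>, the two summands coincide and
          cancel.\<close>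
        case False
        then consider "i = j" | "j = k" | "i = k" by blast
        then show ?thesis
          by cases (simp_all add: cochains_1_singleton[OF assms, simplified] insert_commute bit_add_self
              del: add_bit_eq_xor)
      qed
    qed
  next
    assume ?R
    show ?L
    proof
      fix F
      show "coboundary \<Delta> 1 f F = 0"
      proof (cases "F \<in> \<Delta> \<and> card F = 3")
        case True
        then obtain i j k where F: "F = {i, j, k}" "i \<noteq> j" "j \<noteq> k" "i \<noteq> k"
          using card_3_iff[of F] by auto
        have "f {j, k} + (f {i, k} + f {i, j}) = 0"
          using \<open>?R\<close> True F(1) by (simp only: arith)
        then show ?thesis using tri[of i j k] True F by simp
      next
        case False
        then show ?thesis by (auto simp: coboundary_def)
      qed
    qed
  qed
qed

section \<open>The sign cocycle of a rank one form\<close>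

text \<open>A face carries no order of its vertices, hence the quantification over both of them. For
  a rank one form the diagonal is positive, so only the off-diagonal entry of the edge can be
  negative.\<close>

definition sign_cochain :: "'v::finite set set \<Rightarrow> 'v rpoly set \<Rightarrow> 'v set \<Rightarrow> bit" where
  "sign_cochain \<Delta> q F =
    (if F \<in> \<Delta> \<and> card F = 2 \<and> (\<exists>i\<in>F. \<exists>j\<in>F. form_matrix \<Delta> q $ i $ j < 0) then 1 else 0)"

lemma sign_cochain_in_cochains: "sign_cochain \<Delta> q \<in> cochains \<Delta> 1"
  by (auto simp: sign_cochain_def cochains_def)

context
  fixes \<Delta> :: "'v::finite set set" and q
  assumes complex: "finite_complex \<Delta>" and q: "q \<in> rank_one_forms \<Delta>"
begin

lemma rank_one_form_diag_pos: "form_matrix \<Delta> q $ i $ i > 0"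
  using q rank_one_on_diag_pos[of "{i}"] complex
  by (auto simp: rank_one_forms_iff[OF complex] finite_complex_def)

text \<open>Lets identities between bits be proved as identities between signs of real entries. For
  \<open>i = j\<close> both sides are 1.\<close>

lemma sign_of_sign_cochain:
  assumes "{i, j} \<in> \<Delta>"
  shows "sign_of_bit (sign_cochain \<Delta> q {i, j}) = sgn (form_matrix \<Delta> q $ i $ j)"
proof (cases "i = j")
  case True
  then show ?thesis using rank_one_form_diag_pos[of i] by (simp add: sign_cochain_def)
next
  case False
  let ?X = "form_matrix \<Delta> q"
  obtain u where "\<And>a. a \<in> {i, j} \<Longrightarrow> u a \<noteq> 0"
    "\<And>a b. a \<in> {i, j} \<Longrightarrow> b \<in> {i, j} \<Longrightarrow> ?X $ a $ b = u a * u b"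
    by (rule rank_one_forms_faceE[OF complex q assms]) blast
  then have "?X $ i $ j \<noteq> 0" "?X $ j $ i = ?X $ i $ j" by (auto simp: mult.commute)
  then show ?thesis
    using False assms rank_one_form_diag_pos[of i] rank_one_form_diag_pos[of j]
    by (auto simp: sign_cochain_def sgn_if)
qed

text \<open>The diagonal and the sign cochain determine the form: if an entry is
  \<open>u i * u j\<close>, its absolute value is the product of the square roots of the two
  diagonal entries.\<close>

lemma rank_one_form_entry:
  assumes "{i, j} \<in> \<Delta>"
  shows "form_matrix \<Delta> q $ i $ j = sign_of_bit (sign_cochain \<Delta> q {i, j}) *
    (sqrt (form_matrix \<Delta> q $ i $ i) * sqrt (form_matrix \<Delta> q $ j $ j))"
proof -
  let ?X = "form_matrix \<Delta> q"
  obtain u where "\<And>a. a \<in> {i, j} \<Longrightarrow> u a \<noteq> 0"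
    "\<And>a b. a \<in> {i, j} \<Longrightarrow> b \<in> {i, j} \<Longrightarrow> ?X $ a $ b = u a * u b"
    by (rule rank_one_forms_faceE[OF complex q assms]) blast
  then have "sqrt (?X $ i $ i) * sqrt (?X $ j $ j) = \<bar>?X $ i $ j\<bar>" by (simp add: abs_mult)
  then show ?thesis unfolding sign_of_sign_cochain[OF assms] by (simp add: sgn_mult_abs)
qed

lemma sign_cochain_cocycle: "sign_cochain \<Delta> q \<in> carrier (cocycle_group \<Delta> 1)"
proof -
  let ?X = "form_matrix \<Delta> q"
  have "sign_cochain \<Delta> q {i, k} = sign_cochain \<Delta> q {i, j} + sign_cochain \<Delta> q {j, k}"
    if ijk: "{i, j, k} \<in> \<Delta>" for i j k
  proof -
    have faces: "{i, j} \<in> \<Delta>" "{j, k} \<in> \<Delta>" "{i, k} \<in> \<Delta>"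
      by (rule finite_complex_subface[OF complex ijk]; simp)+
    obtain u where u: "\<And>a. a \<in> {i, j, k} \<Longrightarrow> u a \<noteq> 0"
      "\<And>a b. a \<in> {i, j, k} \<Longrightarrow> b \<in> {i, j, k} \<Longrightarrow> ?X $ a $ b = u a * u b"
      by (rule rank_one_forms_faceE[OF complex q ijk]) blast
    \<comment> \<open>The sign of the middle vertex \<open>j\<close> occurs twice and cancels, which
      is the cocycle condition in multiplicative form.\<close>
    have "sgn (u j) * (sgn (u j) * c) = c" for c
      using u(1)[of j] by (simp add: sgn_if)
    then have "sgn (?X $ i $ k) = sgn (?X $ i $ j) * sgn (?X $ j $ k)"
      by (simp add: u(2) sgn_mult mult.assoc)
    then have "sign_of_bit (sign_cochain \<Delta> q {i, k})
      = sign_of_bit (sign_cochain \<Delta> q {i, j} + sign_cochain \<Delta> q {j, k})"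
      by (simp only: sign_of_bit_add sign_of_sign_cochain[OF faces(1)]
          sign_of_sign_cochain[OF faces(2)] sign_of_sign_cochain[OF faces(3)])
    then show ?thesis by (simp only: sign_of_bit_eq_iff)
  qed
  then have "coboundary \<Delta> 1 (sign_cochain \<Delta> q) = (\<lambda>_. 0)"
    unfolding cocycle_iff[OF sign_cochain_in_cochains] by blast
  then show ?thesis by (simp add: cocycle_group_def sign_cochain_in_cochains[simplified])
qed

end

lemma sign_cochain_hadamard:
  assumes "finite_complex \<Delta>" "q \<in> rank_one_forms \<Delta>" "r \<in> rank_one_forms \<Delta>"
  shows "sign_cochain \<Delta> (hadamard \<Delta> q r) = (\<lambda>F. sign_cochain \<Delta> q F + sign_cochain \<Delta> r F)"
proof (rule cochains_1_eqI[OF sign_cochain_in_cochains])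
  show "(\<lambda>F. sign_cochain \<Delta> q F + sign_cochain \<Delta> r F) \<in> cochains \<Delta> 1"
    using sign_cochain_in_cochains[of \<Delta> q] sign_cochain_in_cochains[of \<Delta> r]
    by (simp add: cochains_def)
  fix i j assume ij: "{i, j} \<in> \<Delta>"
  have "q \<in> R2 \<Delta>" "r \<in> R2 \<Delta>" using assms by (auto intro: rank_one_forms_in_R2)
  then have "sign_of_bit (sign_cochain \<Delta> (hadamard \<Delta> q r) {i, j}) =
    sign_of_bit (sign_cochain \<Delta> q {i, j} + sign_cochain \<Delta> r {i, j})"
    using assms ij hadamard_in_rank_one_forms[OF assms]
    by (simp add: sign_of_sign_cochain sign_of_bit_add form_matrix_hadamard sgn_mult del: add_bit_eq_xor)
  then show "sign_cochain \<Delta> (hadamard \<Delta> q r) {i, j} = sign_cochain \<Delta> q {i, j} + sign_cochain \<Delta> r {i, j}"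
    by (simp only: sign_of_bit_eq_iff)
qed

text \<open>Identifies congruence with being cohomologous; both the well-definedness and the
  injectivity of the final map come from here.\<close>

lemma diag_cong_iff_sign_cochain:
  assumes "finite_complex \<Delta>" "q \<in> rank_one_forms \<Delta>" "r \<in> rank_one_forms \<Delta>"
  shows "(q, r) \<in> diag_cong \<Delta> \<longleftrightarrow>
    (\<exists>h\<in>coboundaries \<Delta> 1. sign_cochain \<Delta> r = (\<lambda>F. h F + sign_cochain \<Delta> q F))"
proof
  assume "(q, r) \<in> diag_cong \<Delta>"
  then obtain d where d: "\<And>i. d i \<noteq> 0"
    "\<And>i j. {i, j} \<in> \<Delta> \<Longrightarrow> form_matrix \<Delta> r $ i $ j = d i * d j * form_matrix \<Delta> q $ i $ j"
    by (rule diag_congE) blast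
  \<comment> \<open>The 0-cochain of signs of \<open>d\<close>; its coboundary records the sign of
    \<open>d i * d j\<close> on each edge.\<close>
  define g where "g F = (if F \<in> \<Delta> \<and> card F = 1 \<and> d (the_elem F) < 0 then 1 else 0 :: bit)" for F
  have g: "g \<in> cochains \<Delta> 0" by (auto simp: g_def cochains_def)
  have sg: "sign_of_bit (g {i}) = sgn (d i)" for i
    using assms(1) d(1)[of i] by (auto simp: g_def finite_complex_def sgn_if)
  have "sign_cochain \<Delta> r = (\<lambda>F. coboundary \<Delta> 0 g F + sign_cochain \<Delta> q F)"
  proof (rule cochains_1_eqI[OF sign_cochain_in_cochains])
    show "(\<lambda>F. coboundary \<Delta> 0 g F + sign_cochain \<Delta> q F) \<in> cochains \<Delta> 1"
      using sign_cochain_in_cochains[of \<Delta> q] coboundary_0_in_cochains[of \<Delta> g]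
      by (simp add: cochains_def)
    fix i j assume ij: "{i, j} \<in> \<Delta>"
    have "sign_of_bit (sign_cochain \<Delta> r {i, j}) =
      sign_of_bit (coboundary \<Delta> 0 g {i, j} + sign_cochain \<Delta> q {i, j})"
      by (simp add: coboundary_0_pair[OF ij] sign_of_bit_add sg sign_of_sign_cochain assms ij d(2)
          sgn_mult del: add_bit_eq_xor)
    then show "sign_cochain \<Delta> r {i, j} = coboundary \<Delta> 0 g {i, j} + sign_cochain \<Delta> q {i, j}"
      by (simp only: sign_of_bit_eq_iff)
  qed
  then show "\<exists>h\<in>coboundaries \<Delta> 1. sign_cochain \<Delta> r = (\<lambda>F. h F + sign_cochain \<Delta> q F)"
    using g by (auto simp: coboundaries_def)
next
  assume "\<exists>h\<in>coboundaries \<Delta> 1. sign_cochain \<Delta> r = (\<lambda>F. h F + sign_cochain \<Delta> q F)"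
  then obtain g where g: "sign_cochain \<Delta> r = (\<lambda>F. coboundary \<Delta> 0 g F + sign_cochain \<Delta> q F)"
    by (auto simp: coboundaries_def)
  let ?X = "form_matrix \<Delta> q" and ?Y = "form_matrix \<Delta> r"
  \<comment> \<open>The diagonal entries force the square of \<open>d i\<close> to be the quotient
    of those of \<open>?Y\<close> and \<open>?X\<close>; the sign that remains free is supplied by
    \<open>g\<close>.\<close>
  define d where "d i = sign_of_bit (g {i}) * (sqrt (?Y $ i $ i) / sqrt (?X $ i $ i))" for i
  have pos: "?X $ i $ i > 0" "?Y $ i $ i > 0" for i
    using rank_one_form_diag_pos assms by blast+
  show "(q, r) \<in> diag_cong \<Delta>"
  proof (rule diag_congI)
    show "q \<in> R2 \<Delta>" "r \<in> R2 \<Delta>" using assms by (auto intro: rank_one_forms_in_R2)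
    show "d i \<noteq> 0" for i using pos[of i] by (simp add: d_def)
    fix i j assume ij: "{i, j} \<in> \<Delta>"
    have "?Y $ i $ j = sign_of_bit (g {i}) * sign_of_bit (g {j}) * sign_of_bit (sign_cochain \<Delta> q {i, j}) *
      (sqrt (?Y $ i $ i) * sqrt (?Y $ j $ j))"
      using rank_one_form_entry[OF assms(1,3) ij]
      by (simp only: g sign_of_bit_add coboundary_0_pair[OF ij])
    also have "\<dots> = d i * d j *
      (sign_of_bit (sign_cochain \<Delta> q {i, j}) * (sqrt (?X $ i $ i) * sqrt (?X $ j $ j)))"
    proof -
      have "sqrt (?X $ i $ i) \<noteq> 0" "sqrt (?X $ j $ j) \<noteq> 0" using pos[of i] pos[of j] by simp_all
      then show ?thesis by (simp add: d_def)
    qed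
    also have "\<dots> = d i * d j * ?X $ i $ j"
      using rank_one_form_entry[OF assms(1,2) ij] by simp
    finally show "?Y $ i $ j = d i * d j * ?X $ i $ j" .
  qed
qed

lemma sign_cochain_surj:
  assumes "finite_complex \<Delta>" "f \<in> carrier (cocycle_group \<Delta> 1)"
  shows "\<exists>q\<in>rank_one_forms \<Delta>. sign_cochain \<Delta> q = f"
proof -
  have f: "f \<in> cochains \<Delta> 1" "coboundary \<Delta> 1 f = (\<lambda>_. 0)"
    using assms(2) by (auto simp: cocycle_group_def)
  \<comment> \<open>The diagonal entries are 1, because a 1-cochain vanishes on singletons.\<close>
  define X :: "real ^ 'a ^ 'a"
    where "X = (\<chi> i j. if {i, j} \<in> \<Delta> then sign_of_bit (f {i, j}) else 0)"
  have X: "partial_matrix \<Delta> X" by (auto simp: partial_matrix_def X_def insert_commute)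
  have "rank_one_on F X" if F: "F \<in> \<Delta>" for F
  proof (cases "F = {}")
    case True
    then show ?thesis by (simp add: rank_one_on_def)
  next
    case False
    then obtain a where a: "a \<in> F" by blast
    \<comment> \<open>The cocycle condition is applied to the possibly degenerate triple
      \<open>i, a, j\<close>, which lies in \<open>F\<close>.\<close>
    have "X $ i $ j = sign_of_bit (f {i, a}) * sign_of_bit (f {j, a})" if "i \<in> F" "j \<in> F" for i j
    proof -
      have "{i, j} \<in> \<Delta>" "{i, a, j} \<in> \<Delta>"
        by (rule finite_complex_subface[OF assms(1) F]; use that a in simp)+
      moreover from this have "f {i, j} = f {i, a} + f {a, j}"
        using f(2) unfolding cocycle_iff[OF f(1)] by blast
      ultimately show ?thesis
        by (simp add: X_def sign_of_bit_add insert_commute del: add_bit_eq_xor)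
    qed
    then show ?thesis
      unfolding rank_one_on_def by (intro exI[of _ "\<lambda>i. sign_of_bit (f {i, a})"]) auto
  qed
  then have q: "form_of \<Delta> X \<in> rank_one_forms \<Delta>"
    by (rule form_of_in_rank_one_forms[OF assms(1) X])
  have "sign_cochain \<Delta> (form_of \<Delta> X) = f"
  proof (rule cochains_1_eqI[OF sign_cochain_in_cochains f(1)])
    fix i j assume ij: "{i, j} \<in> \<Delta>"
    have "sign_of_bit (sign_cochain \<Delta> (form_of \<Delta> X) {i, j}) = sign_of_bit (f {i, j})"
      unfolding sign_of_sign_cochain[OF assms(1) q ij] form_matrix_form_of[OF assms(1) X]
      using ij by (simp add: X_def)
    then show "sign_cochain \<Delta> (form_of \<Delta> X) {i, j} = f {i, j}" by simp
  qed
  then show ?thesis using q by blast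
qed

section \<open>The isomorphism\<close>

text \<open>Commutativity makes the coboundaries a normal subgroup. Modulo 2 every cocycle is its
  own inverse.\<close>

lemma comm_group_cocycle_group: "comm_group (cocycle_group \<Delta> 1)"
proof (rule comm_groupI)
  fix f g assume fg: "f \<in> carrier (cocycle_group \<Delta> 1)" "g \<in> carrier (cocycle_group \<Delta> 1)"
  have "coboundary \<Delta> 1 (\<lambda>F. f F + g F) F = coboundary \<Delta> 1 f F + coboundary \<Delta> 1 g F" for F
    by (simp add: coboundary_def sum.distrib del: add_bit_eq_xor)
  then show "f \<otimes>\<^bsub>cocycle_group \<Delta> 1\<^esub> g \<in> carrier (cocycle_group \<Delta> 1)"
    using fg by (auto simp: cocycle_group_def cochains_def)
next
  fix f assume f: "f \<in> carrier (cocycle_group \<Delta> 1)"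
  then show "\<exists>g\<in>carrier (cocycle_group \<Delta> 1). g \<otimes>\<^bsub>cocycle_group \<Delta> 1\<^esub> f = \<one>\<^bsub>cocycle_group \<Delta> 1\<^esub>"
    by (intro bexI[of _ f]) (simp_all add: cocycle_group_def bit_add_self del: add_bit_eq_xor)
qed (auto simp: cocycle_group_def cochains_def coboundary_def add_ac simp del: add_bit_eq_xor)

lemma subgroup_coboundaries:
  assumes "finite_complex \<Delta>"
  shows "subgroup (coboundaries \<Delta> 1) (cocycle_group \<Delta> 1)"
proof -
  interpret comm_group "cocycle_group \<Delta> 1" by (rule comm_group_cocycle_group)
  have cb: "coboundaries \<Delta> 1 = coboundary \<Delta> 0 ` cochains \<Delta> 0"
    by (simp add: coboundaries_def)
  have closed: "f \<in> carrier (cocycle_group \<Delta> 1)" if "f \<in> coboundaries \<Delta> 1" for f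
  proof -
    obtain g where f: "f = coboundary \<Delta> 0 g" using \<open>f \<in> coboundaries \<Delta> 1\<close> unfolding cb by blast
    have "f {i, k} = f {i, j} + f {j, k}" if "{i, j, k} \<in> \<Delta>" for i j k
    proof -
      have faces: "{i, j} \<in> \<Delta>" "{j, k} \<in> \<Delta>" "{i, k} \<in> \<Delta>"
        by (rule finite_complex_subface[OF assms that]; simp)+
      \<comment> \<open>The composite of two coboundary maps is zero: the value at the middle vertex
        appears twice.\<close>
      have telescope: "a + c = (a + b) + (b + c)" for a b c :: bit
        by (cases a; cases b; cases c) auto
      show ?thesis unfolding f faces[THEN coboundary_0_pair] by (rule telescope)
    qed
    then show ?thesis
      using cocycle_iff[OF coboundary_0_in_cochains[of \<Delta> g]] coboundary_0_in_cochains[of \<Delta> g]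
      by (simp add: cocycle_group_def f)
  qed
  show ?thesis
  proof (rule subgroupI)
    show "coboundaries \<Delta> 1 \<subseteq> carrier (cocycle_group \<Delta> 1)" using closed by blast
    have "(\<lambda>_. 0) \<in> cochains \<Delta> 0" by (simp add: cochains_def)
    then show "coboundaries \<Delta> 1 \<noteq> {}" unfolding cb by blast
  next
    fix f assume f: "f \<in> coboundaries \<Delta> 1"
    have "f \<otimes>\<^bsub>cocycle_group \<Delta> 1\<^esub> f = \<one>\<^bsub>cocycle_group \<Delta> 1\<^esub>"
      by (simp add: cocycle_group_def bit_add_self del: add_bit_eq_xor)
    then show "inv\<^bsub>cocycle_group \<Delta> 1\<^esub> f \<in> coboundaries \<Delta> 1"
      using inv_equality[OF _ closed[OF f] closed[OF f]] f by (simp only:)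
  next
    fix f g assume "f \<in> coboundaries \<Delta> 1" "g \<in> coboundaries \<Delta> 1"
    then obtain a b where ab: "a \<in> cochains \<Delta> 0" "b \<in> cochains \<Delta> 0"
      "f = coboundary \<Delta> 0 a" "g = coboundary \<Delta> 0 b" unfolding cb by blast
    have "(\<lambda>F. a F + b F) \<in> cochains \<Delta> 0" using ab(1,2) by (simp add: cochains_def)
    moreover have "(\<lambda>F. f F + g F) = coboundary \<Delta> 0 (\<lambda>F. a F + b F)"
      by (auto simp: ab coboundary_def fun_eq_iff sum.distrib simp del: add_bit_eq_xor)
    ultimately show "f \<otimes>\<^bsub>cocycle_group \<Delta> 1\<^esub> g \<in> coboundaries \<Delta> 1"
      unfolding cb by (simp add: cocycle_group_def)
  qed
qed

theorem theorem3p7: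
  fixes \<Delta> :: "'v::finite set set"
  assumes "finite_complex \<Delta>"
  shows "(\<forall>A\<in>K1 \<Delta>. \<forall>B\<in>K1 \<Delta>. class_prod \<Delta> A B \<in> K1 \<Delta>) \<and>
    (\<exists>\<phi>. bij_betw \<phi> (K1 \<Delta>) (carrier (cohomology \<Delta> 1)) \<and>
      (\<forall>A\<in>K1 \<Delta>. \<forall>B\<in>K1 \<Delta>.
         \<phi> (class_prod \<Delta> A B) = \<phi> A \<otimes>\<^bsub>cohomology \<Delta> 1\<^esub> \<phi> B))"
proof -
  let ?Z = "cocycle_group \<Delta> 1" and ?B = "coboundaries \<Delta> 1" and ?Q = "rank_one_forms \<Delta>"
  let ?s = "sign_cochain \<Delta>" and ?cl = "\<lambda>q. diag_cong \<Delta> `` {q}"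
  interpret comm_group ?Z by (rule comm_group_cocycle_group)
  interpret normal ?B ?Z by (rule subgroup_imp_normal[OF subgroup_coboundaries[OF assms]])
  have K1: "K1 \<Delta> = ?cl ` ?Q"
    by (auto simp: K1_def quotient_def rank_one_forms_def)
  note R2 = rank_one_forms_in_R2
  have s: "?s q \<in> carrier ?Z" if "q \<in> ?Q" for q
    by (rule sign_cochain_cocycle[OF assms that])
  \<comment> \<open>Equality of cohomology classes amounts to congruence: read from right to left it
    makes \<open>\<phi>\<close> well defined, from left to right injective.\<close>
  have coset_iff: "?B #>\<^bsub>?Z\<^esub> ?s q = ?B #>\<^bsub>?Z\<^esub> ?s r \<longleftrightarrow> (q, r) \<in> diag_cong \<Delta>"
    if "q \<in> ?Q" "r \<in> ?Q" for q r
  proof -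
    have "?B #>\<^bsub>?Z\<^esub> ?s q = ?B #>\<^bsub>?Z\<^esub> ?s r \<longleftrightarrow> ?s r \<in> ?B #>\<^bsub>?Z\<^esub> ?s q"
      using repr_independence[OF _ s[OF that(1)] is_subgroup] rcos_self[OF s[OF that(2)] is_subgroup]
      by auto
    also have "\<dots> \<longleftrightarrow> (\<exists>h\<in>?B. ?s r = (\<lambda>F. h F + ?s q F))"
      by (simp add: r_coset_def cocycle_group_def del: add_bit_eq_xor)
    finally show ?thesis using diag_cong_iff_sign_cochain[OF assms that] by simp
  qed
  \<comment> \<open>No representative has to be chosen: all members of a class in
    \<open>K1 \<Delta>\<close> contribute the same coset, so the union is that coset.\<close>
  define \<phi> where "\<phi> A = (\<Union>q\<in>A. ?B #>\<^bsub>?Z\<^esub> ?s q)" for A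
  have \<phi>: "\<phi> (?cl q) = ?B #>\<^bsub>?Z\<^esub> ?s q" if q: "q \<in> ?Q" for q
  proof -
    have "?B #>\<^bsub>?Z\<^esub> ?s r = ?B #>\<^bsub>?Z\<^esub> ?s q" if "r \<in> ?cl q" for r
      using coset_iff[OF q] rank_one_forms_diag_cong[OF assms q] that by blast
    then have "\<phi> (?cl q) = (\<Union>r\<in>?cl q. ?B #>\<^bsub>?Z\<^esub> ?s q)"
      unfolding \<phi>_def by (rule SUP_cong[OF refl])
    moreover have "q \<in> ?cl q" using equiv_class_self[OF equiv_diag_cong R2[OF q]] .
    ultimately show ?thesis by blast
  qed
  have prod: "class_prod \<Delta> (?cl q) (?cl r) = ?cl (hadamard \<Delta> q r)" "hadamard \<Delta> q r \<in> ?Q"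
    if "q \<in> ?Q" "r \<in> ?Q" for q r
    by (rule class_prod_class[OF assms R2[OF that(1)] R2[OF that(2)]],
        rule hadamard_in_rank_one_forms[OF assms that])
  have "\<forall>A\<in>K1 \<Delta>. \<forall>B\<in>K1 \<Delta>. class_prod \<Delta> A B \<in> K1 \<Delta>"
    unfolding K1 by (simp add: prod)
  moreover have "bij_betw \<phi> (K1 \<Delta>) (carrier (cohomology \<Delta> 1))"
  proof (rule bij_betw_imageI)
    show "inj_on \<phi> (K1 \<Delta>)"
    proof (rule inj_onI)
      fix A B assume AB: "A \<in> K1 \<Delta>" "B \<in> K1 \<Delta>" "\<phi> A = \<phi> B"
      then obtain q r where qr: "q \<in> ?Q" "A = ?cl q" "r \<in> ?Q" "B = ?cl r"
        unfolding K1 by blast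
      then have "(q, r) \<in> diag_cong \<Delta>"
        using AB(3) by (simp only: \<phi> coset_iff)
      then show "A = B" unfolding qr by (rule equiv_class_eq[OF equiv_diag_cong])
    qed
    have "\<phi> ` K1 \<Delta> = (\<lambda>f. ?B #>\<^bsub>?Z\<^esub> f) ` ?s ` ?Q"
      unfolding K1 image_image by (rule image_cong) (simp_all add: \<phi>)
    \<comment> \<open>Surjectivity: every cocycle is the sign cochain of some rank one form.\<close>
    also have "?s ` ?Q = carrier ?Z"
      using s sign_cochain_surj[OF assms] by blast
    finally show "\<phi> ` K1 \<Delta> = carrier (cohomology \<Delta> 1)"
      by (auto simp: cohomology_def FactGroup_def RCOSETS_def)
  qed
  moreover have "\<phi> (class_prod \<Delta> A B) = \<phi> A \<otimes>\<^bsub>cohomology \<Delta> 1\<^esub> \<phi> B"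
    if AB: "A \<in> K1 \<Delta>" "B \<in> K1 \<Delta>" for A B
  proof -
    obtain q r where qr: "q \<in> ?Q" "A = ?cl q" "r \<in> ?Q" "B = ?cl r"
      using AB unfolding K1 by blast
    have "\<phi> (class_prod \<Delta> A B) = ?B #>\<^bsub>?Z\<^esub> ?s (hadamard \<Delta> q r)"
      using qr by (simp add: prod \<phi>)
    also have "?s (hadamard \<Delta> q r) = ?s q \<otimes>\<^bsub>?Z\<^esub> ?s r"
      by (simp add: sign_cochain_hadamard[OF assms qr(1,3)] cocycle_group_def del: add_bit_eq_xor)
    \<comment> \<open>The sum of cocycles passes to the product of cosets in the quotient
      group.\<close>
    also have "?B #>\<^bsub>?Z\<^esub> \<dots> = (?B #>\<^bsub>?Z\<^esub> ?s q) <#>\<^bsub>?Z\<^esub> (?B #>\<^bsub>?Z\<^esub> ?s r)"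
      using rcos_sum[OF s[OF qr(1)] s[OF qr(3)]] by simp
    also have "\<dots> = \<phi> A \<otimes>\<^bsub>cohomology \<Delta> 1\<^esub> \<phi> B"
      using qr by (simp add: \<phi> cohomology_def FactGroup_def)
    finally show ?thesis .
  qed
  ultimately show ?thesis by blast
qed

end
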